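(* For $n\ge 1$, set $$D(n)=\Big\{(x_1,x_2)\in\mathbb{R}^2:\ x_1\in(-n,n),\ x_2\in\Big(-1+\frac{|x_1|}{n},\,1-\frac{|x_1|}{n}\Big)\Big\},$$ and let $\varphi_{D(n)}$ be the first eigenfunction of the Dirichlet Laplacian in $D(n)$. Then there exists an $n$ large enough such that $\varphi_{D(n)}$ is not mid-concave on $D(n)$.
   Context: For a bounded domain $D\subset\mathbb{R}^2$, $\varphi_D$ denotes the first Dirichlet eigenfunction, i.e. the (unique up to normalization) strictly positive function on $D$ with $\Delta\varphi_D+\lambda_1(D)\varphi_D=0$ in $D$ and zero boundary values, where $\lambda_1(D)$ is the first (smallest) Dirichlet eigenvalue of $-\Delta$ in $D$. Mid-concavity: let $D\subset\mathbb{R}^d$ be a convex domain symmetric relative to each coordinate axis (i.e. invariant under changing the sign of any single coordinate). Let $J$ be a line segment in $D$ parallel to the $x_1$-axis which intersects $\partial D$ only at the two points $(-a_1,a_2,\dots,a_d)$ and $(a_1,a_2,\dots,a_d)$, $a_1>0$. A function $F:D\to\mathbb{R}$ is mid-concave on $J$ if it is concave on the segment from $(-a_1/2,a_2,\dots,a_d)$ to $(a_1/2,a_2,\dots,a_d)$. $F$ is mid-concave along the $x_1$-axis if it is mid-concave on every such segment parallel to the $x_1$-axis; mid-concavity along the $x_2$-axis, ..., $x_d$-axis is defined similarly. $F$ is mid-concave on $D$ if it is mid-concave along each coordinate axis. *)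

theory Defs
  imports "HOL-Analysis.Analysis"
begin

definition partial_deriv :: "'n::finite \<Rightarrow> (real^'n \<Rightarrow> real) \<Rightarrow> real^'n \<Rightarrow> real" where
  "partial_deriv i f x = deriv (\<lambda>t. f (x + t *\<^sub>R axis i 1)) 0"

text \<open>These two notions are meant for open \<open>D\<close>.\<close>

definition C1_on :: "(real^'n::finite) set \<Rightarrow> (real^'n \<Rightarrow> real) \<Rightarrow> bool" where
  "C1_on D f \<longleftrightarrow> continuous_on D f \<and>
     (\<forall>i. (\<forall>x\<in>D. (\<lambda>t. f (x + t *\<^sub>R axis i 1)) differentiable (at 0)) \<and>
          continuous_on D (partial_deriv i f))"

definition C2_on :: "(real^'n::finite) set \<Rightarrow> (real^'n \<Rightarrow> real) \<Rightarrow> bool" where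
  "C2_on D f \<longleftrightarrow> C1_on D f \<and> (\<forall>i. C1_on D (partial_deriv i f))"

definition laplacian :: "(real^'n::finite \<Rightarrow> real) \<Rightarrow> real^'n \<Rightarrow> real" where
  "laplacian f x = (\<Sum>i\<in>UNIV. partial_deriv i (partial_deriv i f) x)"

text \<open>
  Classical formulation of the Dirichlet problem: the solution is twice continuously
  differentiable in \<open>D\<close>, continuous up to the boundary, and vanishes there. For bounded domains
  all of whose boundary points are regular (in particular convex ones) this gives the
  same eigenvalues and eigenfunctions as the weak formulation. Functions are total; their
  values outside the closure of \<open>D\<close> are irrelevant.
\<close>

definition dirichlet_solution :: "(real^'n::finite) set \<Rightarrow> real \<Rightarrow> (real^'n \<Rightarrow> real) \<Rightarrow> bool" where
  "dirichlet_solution D lam u \<longleftrightarrow>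
     C2_on D u \<and> (\<forall>x\<in>D. laplacian u x + lam * u x = 0) \<and>
     continuous_on (closure D) u \<and> (\<forall>x\<in>frontier D. u x = 0)"

definition dirichlet_eigenvalue :: "(real^'n::finite) set \<Rightarrow> real \<Rightarrow> bool" where
  "dirichlet_eigenvalue D lam \<longleftrightarrow> (\<exists>u. dirichlet_solution D lam u \<and> (\<exists>x\<in>D. u x \<noteq> 0))"

definition first_dirichlet_eigenvalue :: "(real^'n::finite) set \<Rightarrow> real \<Rightarrow> bool" where
  "first_dirichlet_eigenvalue D lam \<longleftrightarrow>
     dirichlet_eigenvalue D lam \<and> (\<forall>mu. dirichlet_eigenvalue D mu \<longrightarrow> lam \<le> mu)"

text \<open>A predicate rather than a function, since the eigenfunction is unique only up to a
  positive factor.\<close>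

definition first_dirichlet_eigenfunction ::
    "(real^'n::finite) set \<Rightarrow> (real^'n \<Rightarrow> real) \<Rightarrow> bool" where
  "first_dirichlet_eigenfunction D u \<longleftrightarrow>
     (\<exists>lam. first_dirichlet_eigenvalue D lam \<and> dirichlet_solution D lam u) \<and> (\<forall>x\<in>D. u x > 0)"

definition set_coord :: "'n::finite \<Rightarrow> real \<Rightarrow> real^'n \<Rightarrow> real^'n" where
  "set_coord i t a = (\<chi> j. if j = i then t else a $ j)"

text \<open>The segment from \<open>a\<close> to its mirror image in the \<open>i\<close>-th coordinate lies in \<open>D\<close> and
  meets the boundary of \<open>D\<close> exactly at its two endpoints.\<close>

definition axis_chord :: "(real^'n::finite) set \<Rightarrow> 'n \<Rightarrow> real^'n \<Rightarrow> bool" where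
  "axis_chord D i a \<longleftrightarrow> a $ i > 0 \<and>
     open_segment (set_coord i (- (a $ i)) a) a \<subseteq> D \<and>
     closed_segment (set_coord i (- (a $ i)) a) a \<inter> frontier D = {set_coord i (- (a $ i)) a, a}"

text \<open>Intended for convex open \<open>D\<close> invariant under sign changes of single coordinates.\<close>

definition mid_concave_along :: "(real^'n::finite) set \<Rightarrow> 'n \<Rightarrow> (real^'n \<Rightarrow> real) \<Rightarrow> bool" where
  "mid_concave_along D i F \<longleftrightarrow>
     (\<forall>a. axis_chord D i a \<longrightarrow>
        concave_on (closed_segment (set_coord i (- (a $ i) / 2) a) (set_coord i (a $ i / 2) a)) F)"

definition mid_concave :: "(real^'n::finite) set \<Rightarrow> (real^'n \<Rightarrow> real) \<Rightarrow> bool" where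
  "mid_concave D F \<longleftrightarrow> (\<forall>i. mid_concave_along D i F)"

definition rhombus :: "nat \<Rightarrow> (real^2) set" where
  "rhombus n = {x. x $ 1 \<in> {- real n <..< real n} \<and>
     x $ 2 \<in> {- 1 + \<bar>x $ 1\<bar> / real n <..< 1 - \<bar>x $ 1\<bar> / real n}}"

end

theory Submission
  imports Defs "HOL-Real_Asymp.Real_Asymp"
begin

text \<open>
  Let \<open>u\<close> be a positive eigenfunction on the rhombus with half-axes \<open>n\<close> and \<open>1\<close>, and let \<open>M\<close> be
  its maximum, attained at \<open>p\<close>. For large \<open>n\<close> the rhombus looks like a strip near the centre, so the
  eigenvalue \<open>\<lambda>\<close> is close to \<open>\<pi>\<^sup>2/4\<close>, the first eigenvalue of a vertical cross-section of
  length \<open>2\<close>. Where \<open>\<bar>x\<^sub>1\<bar> \<ge> n/16\<close> the cross-sections are shorter by a fixed factor, so their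
  eigenvalues exceed \<open>\<lambda>\<close> by a fixed amount; there \<open>u\<close> must decay exponentially in \<open>\<bar>x\<^sub>1\<bar>\<close>,
  at a rate that does not depend on \<open>n\<close>. At distances proportional to \<open>n\<close> it is then far below
  \<open>M\<close>. A nonnegative function that is concave on a horizontal segment of length
  proportional to \<open>n\<close> cannot do this: it falls at most linearly from its maximum. So \<open>u\<close> is not
  mid-concave, provided that the middle half of the chord through \<open>p\<close> reaches far enough into the region
  of decay, for which \<open>p\<close> has to stay away from the top and bottom vertices.

  All estimates of \<open>u\<close> come from one principle (\<open>laplacian_touching\<close>): if a product
  \<open>A(x\<^sub>1) B(x\<^sub>2)\<close> touches \<open>u\<close> at an interior point, up to a constant, then the Laplacians are ordered
  there. Points of contact are the extrema of a difference or a quotient on a compact set. The three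
  comparison functions are
  \<^item> a product of two cosines on a rectangle, bounding \<open>\<lambda>\<close> from above
    (\<open>eigenvalue_le_of_rectangle_subset\<close>);
  \<^item> a parabola in \<open>x\<^sub>2\<close>, which keeps \<open>p\<close> away from \<open>\<bar>x\<^sub>2\<bar> = 1\<close> (\<open>solution_le_parabola\<close>);
  \<^item> an exponential in \<open>x\<^sub>1\<close> times a cosine in \<open>x\<^sub>2\<close>, giving the decay
    (\<open>solution_exponential_decay\<close>).
\<close>

section \<open>Laplacians at points of contact\<close>

lemma second_deriv_nonneg_at_min:
  fixes f f' :: "real \<Rightarrow> real"
  assumes "e > 0"
    and df: "\<And>t. \<bar>t\<bar> < e \<Longrightarrow> (f has_real_derivative f' t) (at t)"
    and df': "(f' has_real_derivative c) (at 0)"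
    and min: "\<And>t. \<bar>t\<bar> < e \<Longrightarrow> f 0 \<le> f t"
  shows "c \<ge> 0"
proof (rule ccontr)
  assume "\<not> c \<ge> 0"
  have "f' 0 = 0"
    by (rule DERIV_local_min[OF df \<open>e > 0\<close>]) (use min \<open>e > 0\<close> in auto)
  with df' \<open>\<not> c \<ge> 0\<close> obtain d where d: "d > 0" "\<And>h. 0 < h \<Longrightarrow> h < d \<Longrightarrow> f' h < 0"
    using DERIV_neg_dec_right[OF df'] by force
  define r where "r = min d e / 2"
  have r: "0 < r" "r < d" "r < e"
    using \<open>e > 0\<close> d(1) by (auto simp: r_def)
  have "\<exists>z. z > 0 \<and> z < r \<and> f r - f 0 = (r - 0) * f' z"
    by (rule MVT2) (use r df in auto)
  then obtain z where z: "0 < z" "z < r" "f r - f 0 = r * f' z"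
    by auto
  have "f' z < 0"
    using d(2) z r by auto
  then have "f r < f 0"
    using z r mult_pos_neg[of r "f' z"] by linarith
  with min[of r] r show False
    by auto
qed

lemma C1_on_slice_deriv:
  fixes f :: "real^'n::finite \<Rightarrow> real"
  assumes "C1_on D f" and "x + t *\<^sub>R axis i 1 \<in> D"
  shows "((\<lambda>s. f (x + s *\<^sub>R axis i 1)) has_real_derivative partial_deriv i f (x + t *\<^sub>R axis i 1)) (at t)"
proof -
  let ?y = "x + t *\<^sub>R axis i 1"
  have "(\<lambda>s. f (?y + s *\<^sub>R axis i 1)) differentiable (at 0)"
    using assms by (auto simp: C1_on_def)
  then have "((\<lambda>s. f (?y + s *\<^sub>R axis i 1)) has_real_derivative partial_deriv i f ?y) (at 0)"
    unfolding partial_deriv_def by (simp add: DERIV_deriv_iff_real_differentiable)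
  then have "((\<lambda>s. f (x + (s + t) *\<^sub>R axis i 1)) has_real_derivative partial_deriv i f ?y) (at 0)"
    by (simp add: algebra_simps)
  then show ?thesis
    using DERIV_shift[of "\<lambda>s. f (x + s *\<^sub>R axis i 1)" _ 0 t] by simp
qed

text \<open>The sign \<open>s\<close> lets one statement cover contact from below (\<open>s = 1\<close>) and from above
  (\<open>s = -1\<close>). Only the differences \<open>u p - g 0\<close> are compared, so \<open>g\<close> may be off by a constant.\<close>

lemma second_partial_touching:
  fixes u :: "real^'n::finite \<Rightarrow> real" and g g' :: "real \<Rightarrow> real"
  assumes "C2_on D u" "open D" "p \<in> D" "e > 0"
    and dg: "\<And>t. (g has_real_derivative g' t) (at t)"
    and dg': "(g' has_real_derivative c) (at 0)"
    and s: "s = 1 \<or> s = -1"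
    and touch: "\<And>t. \<bar>t\<bar> < e \<Longrightarrow> s * (u p - g 0) \<le> s * (u (p + t *\<^sub>R axis i 1) - g t)"
  shows "s * c \<le> s * partial_deriv i (partial_deriv i u) p"
proof -
  obtain d where d: "d > 0" "ball p d \<subseteq> D"
    using assms(2,3) open_contains_ball by blast
  define r where "r = min d e"
  have inD: "p + t *\<^sub>R axis i 1 \<in> D" if "\<bar>t\<bar> < r" for t
    using that d(2) by (auto simp: r_def dist_norm subset_iff norm_axis_1)
  have C1: "C1_on D u" "C1_on D (partial_deriv i u)"
    using assms(1) by (auto simp: C2_on_def)
  have "0 \<le> s * (partial_deriv i (partial_deriv i u) p - c)"
  proof (rule second_deriv_nonneg_at_min)
    show "r > 0" using d(1) \<open>e > 0\<close> by (simp add: r_def)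
    show "((\<lambda>t. s * (u (p + t *\<^sub>R axis i 1) - g t)) has_real_derivative
        s * (partial_deriv i u (p + t *\<^sub>R axis i 1) - g' t)) (at t)" if "\<bar>t\<bar> < r" for t
      by (intro DERIV_cmult DERIV_diff C1_on_slice_deriv[OF C1(1)] inD that dg)
    show "((\<lambda>t. s * (partial_deriv i u (p + t *\<^sub>R axis i 1) - g' t)) has_real_derivative
        s * (partial_deriv i (partial_deriv i u) p - c)) (at 0)"
      using C1_on_slice_deriv[OF C1(2), of p 0 i] assms(3)
      by (intro DERIV_cmult DERIV_diff dg') simp
    show "s * (u (p + 0 *\<^sub>R axis i 1) - g 0) \<le> s * (u (p + t *\<^sub>R axis i 1) - g t)" if "\<bar>t\<bar> < r" for t
      using touch[of t] that by (simp add: r_def)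
  qed
  then show ?thesis by (simp add: algebra_simps)
qed

text \<open>Along each axis, \<open>u\<close> minus the product has an extremum at \<open>p\<close>, so its second partial
  derivatives there have a definite sign; add the two.\<close>

lemma laplacian_touching:
  fixes u :: "real^2 \<Rightarrow> real" and A A' A'' B B' B'' :: "real \<Rightarrow> real"
  assumes "C2_on D u" "open D" "p \<in> D" "open U" "p \<in> U"
    and dA: "\<And>t. (A has_real_derivative A' t) (at t)" "\<And>t. (A' has_real_derivative A'' t) (at t)"
    and dB: "\<And>t. (B has_real_derivative B' t) (at t)" "\<And>t. (B' has_real_derivative B'' t) (at t)"
    and s: "s = 1 \<or> s = -1"
    and touch: "\<And>x. x \<in> U \<Longrightarrow> s * (u p - A (p $ 1) * B (p $ 2)) \<le> s * (u x - A (x $ 1) * B (x $ 2))"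
  shows "s * (A'' (p $ 1) * B (p $ 2) + A (p $ 1) * B'' (p $ 2)) \<le> s * laplacian u p"
proof -
  obtain e where e: "e > 0" "ball p e \<subseteq> U"
    using assms(4,5) open_contains_ball by blast
  have inU: "p + t *\<^sub>R axis i 1 \<in> U" if "\<bar>t\<bar> < e" for t and i :: 2
    using that e(2) by (auto simp: dist_norm subset_iff norm_axis_1)
  have sh: "((\<lambda>t. f (c + t)) has_real_derivative f' (c + t)) (at t)"
    if "\<And>t. (f has_real_derivative f' t) (at t)" for f f' :: "real \<Rightarrow> real" and c t
    using that[of "c + t"] DERIV_shift[of f _ t c] by (simp add: add.commute)
  have 1: "s * (A'' (p $ 1) * B (p $ 2)) \<le> s * partial_deriv 1 (partial_deriv 1 u) p"
  proof (rule second_partial_touching[OF assms(1-3) e(1) _ _ s])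
    show "((\<lambda>t. A (p $ 1 + t) * B (p $ 2)) has_real_derivative A' (p $ 1 + t) * B (p $ 2)) (at t)" for t
      by (intro DERIV_cmult_right sh dA)
    show "((\<lambda>t. A' (p $ 1 + t) * B (p $ 2)) has_real_derivative A'' (p $ 1) * B (p $ 2)) (at 0)"
      using sh[OF dA(2), of "p $ 1" 0] by (intro DERIV_cmult_right) simp
    show "s * (u p - A (p $ 1 + 0) * B (p $ 2))
        \<le> s * (u (p + t *\<^sub>R axis 1 1) - A (p $ 1 + t) * B (p $ 2))" if "\<bar>t\<bar> < e" for t
      using touch[OF inU[OF that, of 1]] by (simp add: axis_def)
  qed
  have 2: "s * (A (p $ 1) * B'' (p $ 2)) \<le> s * partial_deriv 2 (partial_deriv 2 u) p"
  proof (rule second_partial_touching[OF assms(1-3) e(1) _ _ s])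
    show "((\<lambda>t. A (p $ 1) * B (p $ 2 + t)) has_real_derivative A (p $ 1) * B' (p $ 2 + t)) (at t)" for t
      by (intro DERIV_cmult sh dB)
    show "((\<lambda>t. A (p $ 1) * B' (p $ 2 + t)) has_real_derivative A (p $ 1) * B'' (p $ 2)) (at 0)"
      using sh[OF dB(2), of "p $ 2" 0] by (intro DERIV_cmult) simp
    show "s * (u p - A (p $ 1) * B (p $ 2 + 0))
        \<le> s * (u (p + t *\<^sub>R axis 2 1) - A (p $ 1) * B (p $ 2 + t))" if "\<bar>t\<bar> < e" for t
      using touch[OF inU[OF that, of 2]] by (simp add: axis_def)
  qed
  show ?thesis
    using 1 2 by (simp add: laplacian_def sum_2 algebra_simps)
qed

section \<open>Comparison with explicit functions\<close>

lemma cos_derivs: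
  fixes c k t :: real
  shows "((\<lambda>t. c * cos (k * t)) has_real_derivative - c * k * sin (k * t)) (at t)"
    and "((\<lambda>t. - c * k * sin (k * t)) has_real_derivative - c * k\<^sup>2 * cos (k * t)) (at t)"
  by (auto intro!: derivative_eq_intros simp: power2_eq_square)

lemma compact_rectangle: "compact {x :: real^2. \<bar>x $ 1\<bar> \<le> L \<and> \<bar>x $ 2\<bar> \<le> h}"
proof -
  have "{x :: real^2. \<bar>x $ 1\<bar> \<le> L \<and> \<bar>x $ 2\<bar> \<le> h} = cbox (vector [-L, -h]) (vector [L, h])"
    by (auto simp: mem_box_cart forall_2 abs_le_iff)
  then show ?thesis by simp
qed

lemma cos_pos_of_abs_less: "cos (pi / (2 * r) * t) > 0" if "\<bar>t\<bar> < r" for r t :: real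
proof -
  have "\<bar>pi / (2 * r) * t\<bar> < pi / 2"
  proof -
    have "\<bar>t\<bar> / r < 1" "r > 0"
      using that by auto
    then have "pi / 2 * (\<bar>t\<bar> / r) < pi / 2 * 1"
      by (intro mult_strict_left_mono) auto
    then show ?thesis
      using \<open>r > 0\<close> by (simp add: abs_mult)
  qed
  then show ?thesis
    by (intro cos_gt_zero_pi) linarith+
qed

text \<open>The right-hand side is the first eigenvalue of the rectangle, with the product \<open>v\<close> of cosines
  as eigenfunction. Scaled so that it touches \<open>u\<close> from below, \<open>v\<close> has its point of contact in the open
  rectangle, since \<open>v\<close> vanishes on the sides and \<open>u\<close> does not; at that point the two
  eigenvalue equations can be compared.\<close>

lemma eigenvalue_le_of_rectangle_subset:
  fixes u :: "real^2 \<Rightarrow> real"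
  assumes D: "open D" and C2: "C2_on D u" and eq: "\<forall>x\<in>D. laplacian u x + lam * u x = 0"
    and pos: "\<forall>x\<in>D. u x > 0"
    and "L > 0" "h > 0" and R: "{x. \<bar>x $ 1\<bar> \<le> L \<and> \<bar>x $ 2\<bar> \<le> h} \<subseteq> D"
  shows "lam \<le> (pi / (2 * L))\<^sup>2 + (pi / (2 * h))\<^sup>2"
proof -
  let ?R = "{x :: real^2. \<bar>x $ 1\<bar> \<le> L \<and> \<bar>x $ 2\<bar> \<le> h}"
  let ?U = "{x :: real^2. \<bar>x $ 1\<bar> < L \<and> \<bar>x $ 2\<bar> < h}"
  define k l where "k = pi / (2 * L)" and "l = pi / (2 * h)"
  define v where "v = (\<lambda>x :: real^2. cos (k * x $ 1) * cos (l * x $ 2))"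
  have contu: "continuous_on ?R u"
    using C2 R by (auto simp: C2_on_def C1_on_def intro: continuous_on_subset)
  have "continuous_on ?R (\<lambda>x. v x / u x)"
    unfolding v_def using pos R
    by (intro continuous_intros contu) force
  moreover have "0 \<in> ?R" using \<open>L > 0\<close> \<open>h > 0\<close> by simp
  ultimately obtain p where p: "p \<in> ?R" and max: "\<And>x. x \<in> ?R \<Longrightarrow> v x / u x \<le> v p / u p"
    using continuous_attains_sup[OF compact_rectangle, of L h "\<lambda>x. v x / u x"] by blast
  have posR: "u x > 0" if "x \<in> ?R" for x
    using that pos R by blast
  have vp: "v p > 0"
  proof -
    have "0 < v 0 / u 0"
      using posR[of 0] \<open>0 \<in> ?R\<close> by (simp add: v_def)
    also have "\<dots> \<le> v p / u p"
      by (rule max) fact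
    finally show ?thesis
      using posR[OF p] by (simp add: zero_less_divide_iff)
  qed
  have "p \<in> ?U"
  proof -
    have "cos (k * p $ 1) = 0" if "\<bar>p $ 1\<bar> = L"
      using that \<open>L > 0\<close> by (auto simp: k_def abs_if split: if_splits)
    moreover have "cos (l * p $ 2) = 0" if "\<bar>p $ 2\<bar> = h"
      using that \<open>h > 0\<close> by (auto simp: l_def abs_if split: if_splits)
    ultimately show ?thesis
      using p vp by (force simp: v_def)
  qed
  define c where "c = u p / v p"
  have cp: "c > 0" "c * v p = u p"
    using vp posR[OF p] by (auto simp: c_def)
  have below: "c * v x \<le> u x" if "x \<in> ?U" for x
    using max[of x] posR[of x] posR[OF p] vp that by (simp add: c_def field_simps)
  have "open ?U"
    by (intro open_Collect_conj open_Collect_less continuous_intros)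
  from laplacian_touching[where A = "\<lambda>t. c * cos (k * t)" and B = "\<lambda>t. 1 * cos (l * t)" and s = 1,
      OF C2 D _ this \<open>p \<in> ?U\<close> cos_derivs cos_derivs]
  have "- c * k\<^sup>2 * cos (k * p $ 1) * cos (l * p $ 2) - c * cos (k * p $ 1) * l\<^sup>2 * cos (l * p $ 2)
      \<le> laplacian u p"
    using below cp p R by (force simp: v_def algebra_simps)
  then have "- (k\<^sup>2 + l\<^sup>2) * (c * v p) \<le> laplacian u p"
    by (simp add: v_def algebra_simps)
  also have "laplacian u p = - lam * u p"
    using eq p R by force
  finally have "lam * u p \<le> (k\<^sup>2 + l\<^sup>2) * u p"
    using cp by (simp add: algebra_simps)
  then show ?thesis
    using posR[OF p] by (simp add: k_def l_def)
qed

text \<open>The parabola has Laplacian \<open>- K * M\<close>, which is strictly below the Laplacian \<open>- lam * u\<close> of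
  \<open>u\<close>, because \<open>lam < K\<close> and \<open>0 \<le> u \<le> M\<close>. So \<open>u\<close> minus the parabola has no maximum in the interior, and on the
  frontier it is at most \<open>0\<close>. At a maximum point of \<open>u\<close>, where \<open>u = M\<close>, the conclusion bounds
  \<open>\<bar>x $ 2\<bar>\<close> away from \<open>1\<close>.\<close>

lemma solution_le_parabola:
  fixes u :: "real^2 \<Rightarrow> real"
  assumes D: "open D" "bounded D" and sol: "dirichlet_solution D lam u"
    and strip: "\<And>x. x \<in> closure D \<Longrightarrow> \<bar>x $ 2\<bar> \<le> 1"
    and M: "M > 0" "\<And>x. x \<in> D \<Longrightarrow> 0 \<le> u x \<and> u x \<le> M"
    and K: "lam < K" "K > 0" and x: "x \<in> D"
  shows "u x \<le> K * M / 2 * (1 - (x $ 2)\<^sup>2)"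
proof (rule ccontr)
  define w where "w = (\<lambda>y. K * M / 2 * (1 - y\<^sup>2))"
  assume "\<not> ?thesis"
  then have ux: "u x - w (x $ 2) > 0" by (simp add: w_def)
  have C2: "C2_on D u" and eq: "\<And>x. x \<in> D \<Longrightarrow> laplacian u x = - lam * u x"
    and cont: "continuous_on (closure D) u" and bd: "\<And>x. x \<in> frontier D \<Longrightarrow> u x = 0"
    using sol by (fastforce simp: dirichlet_solution_def)+
  have xc: "x \<in> closure D" using x closure_subset by auto
  have "continuous_on (closure D) (\<lambda>x. u x - w (x $ 2))"
    unfolding w_def by (intro continuous_intros cont)
  with D xc obtain p where p: "p \<in> closure D"
    and max: "\<And>y. y \<in> closure D \<Longrightarrow> u y - w (y $ 2) \<le> u p - w (p $ 2)"
    using continuous_attains_sup[of "closure D" "\<lambda>x. u x - w (x $ 2)"] by (metis compact_closure empty_iff)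
  have "w (p $ 2) \<ge> 0"
    using strip[OF p] K M by (auto simp: w_def abs_square_le_1)
  with max[OF xc] ux have "u p > 0" by linarith
  with bd[of p] p D have pD: "p \<in> D"
    by (auto simp: frontier_def interior_open)
  have "- 1 * (0 * w (p $ 2) + 1 * - (K * M)) \<le> - 1 * laplacian u p"
  proof (rule laplacian_touching[where U = D and A' = "\<lambda>_. 0" and B' = "\<lambda>y. - (K * M) * y", OF C2 D(1) pD D(1) pD])
    show "(w has_real_derivative - (K * M) * t) (at t)" for t
      unfolding w_def by (auto intro!: derivative_eq_intros)
    show "((\<lambda>y. - (K * M) * y) has_real_derivative - (K * M)) (at t)" for t
      by (auto intro!: derivative_eq_intros)
    show "- 1 * (u p - 1 * w (p $ 2)) \<le> - 1 * (u y - 1 * w (y $ 2))" if "y \<in> D" for y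
      using max[of y] that closure_subset[of D] by auto
  qed auto
  then have "K * M \<le> lam * u p"
    using eq[OF pD] by simp
  moreover have "lam * u p < K * M"
  proof (cases "lam \<le> 0")
    case True
    then have "lam * u p \<le> 0" using M(2)[OF pD] by (simp add: mult_nonpos_nonneg)
    then show ?thesis using K M by (smt (verit) mult_pos_pos)
  next
    case False
    then have "lam * u p \<le> lam * M" using M(2)[OF pD] by simp
    also have "\<dots> < K * M" using K M by simp
    finally show ?thesis .
  qed
  ultimately show False by simp
qed

text \<open>Here \<open>\<sigma>\<close> chooses the right or the left end of the domain. The comparison function \<open>w\<close>
  has Laplacian \<open>\<kappa>\<^sup>2 - (pi / (2 * H))\<^sup>2\<close> times itself, so by the assumption on \<open>lam\<close> it is a strict
  supersolution, and the quotient \<open>u / w\<close> has no positive maximum in the interior of the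
  narrow part \<open>S\<close>. The cosine has its zeros at height \<open>H > r\<close>, outside \<open>S\<close>,
  so \<open>w\<close> is bounded below on the edge where \<open>\<sigma> * x $ 1 = a\<close>, which gives the constant.\<close>

lemma solution_exponential_decay:
  fixes u :: "real^2 \<Rightarrow> real"
  assumes D: "open D" "bounded D" and sol: "dirichlet_solution D lam u"
    and M: "M > 0" "\<And>x. x \<in> D \<Longrightarrow> u x \<le> M"
    and \<sigma>: "\<sigma>\<^sup>2 = 1"
    and narrow: "\<And>x. x \<in> closure D \<Longrightarrow> a \<le> \<sigma> * x $ 1 \<Longrightarrow> \<bar>x $ 2\<bar> \<le> r"
    and r: "0 \<le> r" "r < H" and lam: "lam + \<kappa>\<^sup>2 < (pi / (2 * H))\<^sup>2"
    and x: "x \<in> D" "a \<le> \<sigma> * x $ 1"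
  shows "u x \<le> M / cos (pi / (2 * H) * r) * exp (- \<kappa> * (\<sigma> * x $ 1 - a))"
proof -
  define l where "l = pi / (2 * H)"
  define S where "S = closure D \<inter> {x. a \<le> \<sigma> * x $ 1}"
  define C where "C = M / cos (l * r)"
  define E where "E = (\<lambda>t. exp (- \<kappa> * (\<sigma> * t - a)))"
  define w where "w = (\<lambda>x :: real^2. E (x $ 1) * cos (l * x $ 2))"
  have C2: "C2_on D u" and eq: "\<And>x. x \<in> D \<Longrightarrow> laplacian u x = - lam * u x"
    and cont: "continuous_on (closure D) u" and bd: "\<And>x. x \<in> frontier D \<Longrightarrow> u x = 0"
    using sol by (fastforce simp: dirichlet_solution_def)+
  have cosr: "cos (l * r) > 0"
    unfolding l_def using r by (intro cos_pos_of_abs_less) simp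
  have cos_ge: "cos (l * r) \<le> cos (l * y)" if "\<bar>y\<bar> \<le> r" for y
  proof -
    have "\<bar>l * y\<bar> \<le> l * r" "l * r \<le> pi"
      using that r by (auto simp: l_def abs_mult divide_simps intro!: mult_left_mono mult_mono)
    then have "cos (l * r) \<le> cos \<bar>l * y\<bar>"
      by (intro cos_monotone_0_pi_le) auto
    then show ?thesis by simp
  qed
  have wpos: "w y > 0" if "y \<in> S" for y
    using cos_ge[OF narrow, of y] cosr that by (auto simp: w_def E_def S_def)
  have "continuous_on S u"
    using cont by (auto simp: S_def intro: continuous_on_subset)
  then have "continuous_on S (\<lambda>x. u x / w x)"
    using wpos unfolding w_def E_def
    by (intro continuous_intros) force+
  moreover have "compact S"
    unfolding S_def using D(2)
    by (intro compact_Int_closed closed_Collect_le continuous_intros) (auto simp: compact_closure)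
  moreover have xS: "x \<in> S"
    using x closure_subset[of D] by (auto simp: S_def)
  ultimately obtain p where p: "p \<in> S" and max: "\<And>y. y \<in> S \<Longrightarrow> u y / w y \<le> u p / w p"
    using continuous_attains_sup[of S "\<lambda>x. u x / w x"] by blast
  define c where "c = u p / w p"
  have cp: "c * w p = u p"
    using wpos[OF p] by (simp add: c_def)
  have above: "u y \<le> c * w y" if "y \<in> S" for y
    using max[OF that] wpos[OF that] by (simp add: c_def pos_divide_le_eq)
  have "c \<le> C"
  proof (rule ccontr)
    assume "\<not> c \<le> C"
    have "C > 0" using M cosr by (simp add: C_def)
    with \<open>\<not> c \<le> C\<close> have "c > 0" by simp
    then have up: "u p > 0"
      using cp wpos[OF p] by (metis mult_pos_pos)
    with bd[of p] p D have pD: "p \<in> D"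
      by (auto simp: S_def frontier_def interior_open)
    have "\<sigma> * p $ 1 \<noteq> a"
    proof
      assume "\<sigma> * p $ 1 = a"
      then have "w p = cos (l * p $ 2)" by (simp add: w_def E_def)
      then have "cos (l * r) \<le> w p"
        using cos_ge[OF narrow, of p] p by (auto simp: S_def)
      then have "C * cos (l * r) < c * w p"
        using \<open>\<not> c \<le> C\<close> cosr \<open>C > 0\<close> by (intro mult_less_le_imp_less) auto
      then show False
        using cp M(2)[OF pD] cosr by (simp add: C_def)
    qed
    then have pU: "p \<in> D \<inter> {x. a < \<sigma> * x $ 1}"
      using p pD by (auto simp: S_def)
    have "- 1 * (c * \<kappa>\<^sup>2 * E (p $ 1) * (1 * cos (l * p $ 2)) + c * E (p $ 1) * (- 1 * l\<^sup>2 * cos (l * p $ 2)))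
        \<le> - 1 * laplacian u p"
    proof (rule laplacian_touching[where A' = "\<lambda>t. c * (- \<kappa> * \<sigma>) * E t" and A'' = "\<lambda>t. c * \<kappa>\<^sup>2 * E t" and B' = "\<lambda>t. - 1 * l * sin (l * t)", OF C2 D(1) pD _ pU])
      show "open (D \<inter> {x. a < \<sigma> * x $ 1})"
        using D by (intro open_Int open_Collect_less continuous_intros)
      show "((\<lambda>t. c * E t) has_real_derivative c * (- \<kappa> * \<sigma>) * E t) (at t)" for t
        unfolding E_def by (auto intro!: derivative_eq_intros)
      show "((\<lambda>t. c * (- \<kappa> * \<sigma>) * E t) has_real_derivative c * \<kappa>\<^sup>2 * E t) (at t)" for t
        unfolding E_def using \<sigma> by (auto intro!: derivative_eq_intros simp: power2_eq_square)
      show "- 1 * (u p - c * E (p $ 1) * (1 * cos (l * p $ 2))) \<le> - 1 * (u y - c * E (y $ 1) * (1 * cos (l * y $ 2)))"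
        if "y \<in> D \<inter> {x. a < \<sigma> * x $ 1}" for y
        using above[of y] cp that closure_subset[of D] by (auto simp: w_def S_def mult.assoc)
    qed (rule cos_derivs | simp)+
    then have "(l\<^sup>2 - \<kappa>\<^sup>2) * (c * w p) \<le> lam * u p"
      using eq[OF pD] by (simp add: w_def algebra_simps)
    then have "l\<^sup>2 - \<kappa>\<^sup>2 \<le> lam"
      using cp up by simp
    then show False
      using lam by (simp add: l_def)
  qed
  have "u x \<le> c * w x" by (rule above[OF xS])
  also have "\<dots> \<le> C * w x"
    using \<open>c \<le> C\<close> wpos[OF xS] by simp
  also have "\<dots> \<le> C * E (x $ 1)"
    using M cosr by (intro mult_left_mono) (auto simp: w_def E_def C_def)
  finally show ?thesis by (simp add: C_def E_def l_def)
qed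

section \<open>Chords of the rhombus\<close>

lemma mem_rhombus_iff: "n \<ge> 1 \<Longrightarrow> x \<in> rhombus n \<longleftrightarrow> \<bar>x $ 1\<bar> / real n + \<bar>x $ 2\<bar> < 1"
proof -
  assume "n \<ge> 1"
  then have "\<bar>x $ 1\<bar> < real n \<longleftrightarrow> \<bar>x $ 1\<bar> / real n < 1" by simp
  then show ?thesis by (auto simp: rhombus_def)
qed

lemma open_rhombus: "n \<ge> 1 \<Longrightarrow> open (rhombus n)"
proof -
  assume "n \<ge> 1"
  then have "rhombus n = {x. \<bar>x $ 1\<bar> / real n + \<bar>x $ 2\<bar> < 1}"
    using mem_rhombus_iff by blast
  moreover have "open {x :: real^2. \<bar>x $ 1\<bar> / real n + \<bar>x $ 2\<bar> < 1}"
    using \<open>n \<ge> 1\<close> by (intro open_Collect_less continuous_intros) auto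
  ultimately show ?thesis by simp
qed

lemma closure_rhombus_le:
  assumes "n \<ge> 1" "x \<in> closure (rhombus n)"
  shows "\<bar>x $ 1\<bar> / real n + \<bar>x $ 2\<bar> \<le> 1"
proof -
  have "closed {x :: real^2. \<bar>x $ 1\<bar> / real n + \<bar>x $ 2\<bar> \<le> 1}"
    using assms(1) by (intro closed_Collect_le continuous_intros) auto
  then have "closure (rhombus n) \<subseteq> {x. \<bar>x $ 1\<bar> / real n + \<bar>x $ 2\<bar> \<le> 1}"
    using mem_rhombus_iff[OF assms(1)] by (intro closure_minimal) auto
  with assms(2) show ?thesis by auto
qed

lemma bounded_rhombus: "bounded (rhombus n)"
proof (rule bounded_subset[OF compact_imp_bounded[OF compact_rectangle]])
  show "rhombus n \<subseteq> {x. \<bar>x $ 1\<bar> \<le> real n \<and> \<bar>x $ 2\<bar> \<le> 1}"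
  proof
    fix x assume x: "x \<in> rhombus n"
    have "\<bar>x $ 1\<bar> / real n \<ge> 0" by simp
    then show "x \<in> {x. \<bar>x $ 1\<bar> \<le> real n \<and> \<bar>x $ 2\<bar> \<le> 1}"
      using x unfolding rhombus_def mem_Collect_eq greaterThanLessThan_iff by linarith
  qed
qed

lemma set_coord_nth: "set_coord i t a $ j = (if j = i then t else a $ j)"
  by (simp add: set_coord_def)

lemma set_coord_convex_combination:
  "u + v = 1 \<Longrightarrow> u *\<^sub>R set_coord i s a + v *\<^sub>R set_coord i t a = set_coord i (u * s + v * t) a"
  by (simp add: vec_eq_iff set_coord_nth flip: distrib_right)

lemma set_coord_mem_closed_segment:
  assumes "s \<le> r" "r \<le> t" "s < t"
  shows "set_coord i r a \<in> closed_segment (set_coord i s a) (set_coord i t a)"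
proof -
  define v where "v = (r - s) / (t - s)"
  have "0 \<le> v" "v \<le> 1" "(1 - v) * s + v * t = r"
    using assms by (auto simp: v_def divide_simps) (auto simp: algebra_simps)
  then show ?thesis
    unfolding closed_segment_def using set_coord_convex_combination[of "1 - v" v i s a t]
    by force
qed

lemma axis_chord_rhombus:
  fixes p :: "real^2"
  assumes n: "n \<ge> 1" and p: "\<bar>p $ 2\<bar> < 1"
  shows "axis_chord (rhombus n) 1 (set_coord 1 (real n * (1 - \<bar>p $ 2\<bar>)) p)"
proof -
  define b where "b = real n * (1 - \<bar>p $ 2\<bar>)"
  define l r where "l = set_coord 1 (- b) p" and "r = set_coord 1 b p"
  have b: "b > 0" using n p by (simp add: b_def)
  have two: "(2 :: 2) \<noteq> 1" by simp
  have inD: "set_coord 1 s p \<in> rhombus n \<longleftrightarrow> \<bar>s\<bar> < b" for s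
    using n two by (auto simp: mem_rhombus_iff set_coord_nth b_def field_simps)
  have "l \<noteq> r"
    using b by (auto simp: l_def r_def vec_eq_iff set_coord_nth)
  have seg: "open_segment l r \<subseteq> rhombus n"
  proof
    fix x assume "x \<in> open_segment l r"
    then obtain v where v: "0 < v" "v < 1" "x = (1 - v) *\<^sub>R l + v *\<^sub>R r"
      by (auto simp: in_segment)
    then have x: "x = set_coord 1 ((1 - v) * (- b) + v * b) p"
      by (simp add: l_def r_def set_coord_convex_combination)
    have "(1 - v) * (- b) + v * b < b" "- b < (1 - v) * (- b) + v * b"
      using v(1,2) b by (simp_all add: algebra_simps)
    then show "x \<in> rhombus n"
      unfolding x inD by linarith
  qed
  have "closed_segment l r \<subseteq> closure (rhombus n)"
    using closure_mono[OF seg] \<open>l \<noteq> r\<close> by simp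
  then have "l \<in> closure (rhombus n)" "r \<in> closure (rhombus n)"
    by auto
  moreover have "l \<notin> rhombus n" "r \<notin> rhombus n"
    using inD b by (auto simp: l_def r_def)
  ultimately have "closed_segment l r \<inter> frontier (rhombus n) = {l, r}"
    using seg open_rhombus[OF n] closed_segment_eq_open[of l r]
    by (auto simp: frontier_def interior_open)
  moreover have "set_coord 1 (- (r $ 1)) r = l" "r $ 1 = b"
    by (auto simp: l_def r_def vec_eq_iff set_coord_nth)
  ultimately show ?thesis
    using seg b unfolding axis_chord_def b_def[symmetric] r_def[symmetric] by auto
qed

text \<open>Mid-concavity, read off at the height of a given point \<open>p\<close>: its chord has half-length
  \<open>n (1 - \<bar>p\<^sub>2\<bar>)\<close>, of which the middle half remains.\<close>

lemma mid_concave_rhombus_row: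
  fixes p :: "real^2"
  assumes "mid_concave (rhombus n) F" "n \<ge> 1" "\<bar>p $ 2\<bar> < 1"
  shows "concave_on (closed_segment (set_coord 1 (- (real n * (1 - \<bar>p $ 2\<bar>) / 2)) p)
           (set_coord 1 (real n * (1 - \<bar>p $ 2\<bar>) / 2) p)) F"
proof -
  define b where "b = real n * (1 - \<bar>p $ 2\<bar>)"
  have "concave_on (closed_segment (set_coord 1 (- b / 2) (set_coord 1 b p))
         (set_coord 1 (b / 2) (set_coord 1 b p))) F"
    using assms(1) axis_chord_rhombus[OF assms(2,3)]
    unfolding mid_concave_def mid_concave_along_def b_def[symmetric]
    by (force simp: set_coord_nth)
  moreover have "set_coord 1 s (set_coord 1 t p) = set_coord 1 s p" for s t
    by (simp add: vec_eq_iff set_coord_nth)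
  ultimately show ?thesis by (simp add: b_def)
qed

section \<open>Eigenfunctions of long rhombi\<close>

text \<open>A rectangle with half-sides \<open>10\<close> and \<open>99/100\<close> fits into the rhombus when
  \<open>10/n + 99/100 < 1\<close>, that is \<open>n > 1000\<close>. Its eigenvalue exceeds \<open>\<pi>\<^sup>2/4\<close> by about three percent,
  less than the gain from the shorter cross-sections used below.\<close>

lemma eigenvalue_rhombus_le:
  assumes n: "n > 1000" and u: "dirichlet_solution (rhombus n) lam u" "\<forall>x\<in>rhombus n. u x > 0"
  shows "lam \<le> (pi / 20)\<^sup>2 + (pi / (2 * (99 / 100)))\<^sup>2"
proof -
  have "{x. \<bar>x $ 1\<bar> \<le> 10 \<and> \<bar>x $ 2\<bar> \<le> 99 / 100} \<subseteq> rhombus n"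
  proof clarify
    fix x :: "real^2" assume x: "\<bar>x $ 1\<bar> \<le> 10" "\<bar>x $ 2\<bar> \<le> 99 / 100"
    have "\<bar>x $ 1\<bar> / real n \<le> 10 / real n"
      using x by (intro divide_right_mono) auto
    also have "\<dots> < 1 / 100"
      using n by (simp add: field_simps)
    finally have "\<bar>x $ 1\<bar> / real n + \<bar>x $ 2\<bar> < 1"
      using x(2) by linarith
    then show "x \<in> rhombus n"
      using n by (simp add: mem_rhombus_iff)
  qed
  then show ?thesis
    using eigenvalue_le_of_rectangle_subset[of "rhombus n" u lam 10 "99 / 100"] u n
      open_rhombus[of n]
    by (simp add: dirichlet_solution_def)
qed

text \<open>The decay lemma applies with \<open>a = n/16\<close>, where the cross-sections have half-length at most
  \<open>r = 15/16\<close>. Any \<open>H\<close> strictly between \<open>r\<close> and \<open>1\<close> leaves room for a rate \<open>\<kappa>\<close> independent of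
  \<open>n\<close>, provided that the bound on \<open>lam\<close> is close enough to \<open>\<pi>\<^sup>2/4\<close>; here \<open>H = 31/32\<close> and \<open>\<kappa> = \<pi>/20\<close>.
  The point \<open>x\<close> lies at horizontal distance at least \<open>3n/32 - n/16 = n/32\<close> inside the narrow part.\<close>

lemma positive_solution_rhombus_decay:
  assumes n: "n > 1000" and u: "dirichlet_solution (rhombus n) lam u" "\<forall>x\<in>rhombus n. u x > 0"
    and M: "M > 0" "\<And>x. x \<in> rhombus n \<Longrightarrow> u x \<le> M"
    and x: "x \<in> rhombus n" "3 * real n / 32 \<le> \<bar>x $ 1\<bar>"
  shows "u x \<le> M / cos (pi / (2 * (31 / 32)) * (15 / 16)) * exp (- (pi / 640) * real n)"
proof -
  define \<sigma> where "\<sigma> = (if x $ 1 \<ge> 0 then 1 else - 1 :: real)"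
  have \<sigma>: "\<sigma> * x $ 1 = \<bar>x $ 1\<bar>" by (simp add: \<sigma>_def)
  have cpos: "cos (pi / (2 * (31 / 32)) * (15 / 16)) > 0"
    by (rule cos_pos_of_abs_less) simp
  have "u x \<le> M / cos (pi / (2 * (31 / 32)) * (15 / 16)) * exp (- (pi / 20) * (\<sigma> * x $ 1 - real n / 16))"
  proof (rule solution_exponential_decay[OF _ bounded_rhombus u(1) M])
    show "\<sigma>\<^sup>2 = 1" by (simp add: \<sigma>_def)
    show "\<bar>y $ 2\<bar> \<le> 15 / 16" if "y \<in> closure (rhombus n)" "real n / 16 \<le> \<sigma> * y $ 1" for y
    proof -
      have "real n / 16 \<le> \<bar>y $ 1\<bar>"
        using that(2) by (auto simp: \<sigma>_def split: if_splits)
      then have "1 / 16 \<le> \<bar>y $ 1\<bar> / real n"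
        using n by (simp add: field_simps)
      then show ?thesis
        using closure_rhombus_le[OF _ that(1)] n by linarith
    qed
    (* 2 / 400 + (50 / 99)^2 < 0.2601 and (16 / 31)^2 > 0.2663 *)
    have "lam + (pi / 20)\<^sup>2 \<le> pi\<^sup>2 * (2 * (1 / 20)\<^sup>2 + (50 / 99)\<^sup>2)"
      using eigenvalue_rhombus_le[OF n u] by (simp add: power_divide)
    also have "\<dots> < pi\<^sup>2 * (16 / 31)\<^sup>2"
      by (intro mult_strict_left_mono) (auto simp: power2_eq_square)
    finally show "lam + (pi / 20)\<^sup>2 < (pi / (2 * (31 / 32)))\<^sup>2"
      by (simp add: power_divide power_mult_distrib)
  qed (use n x \<sigma> in \<open>auto simp: open_rhombus\<close>)
  also have "\<dots> \<le> M / cos (pi / (2 * (31 / 32)) * (15 / 16)) * exp (- (pi / 640) * real n)"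
  proof -
    have "pi / 20 * (real n / 32) \<le> pi / 20 * (\<sigma> * x $ 1 - real n / 16)"
      using x(2) \<sigma> by (intro mult_left_mono) auto
    then show ?thesis
      using M cpos by (intro mult_left_mono) auto
  qed
  finally show ?thesis .
qed

text \<open>Decay forces \<open>\<bar>p\<^sub>1\<bar> < 3n/32\<close> for the maximum point \<open>p\<close>, and the parabola forces
  \<open>\<bar>p\<^sub>2\<bar> < 3/4\<close>, so the middle half of the chord through \<open>p\<close> contains all abscissae up to \<open>n/8\<close>
  in absolute value. Concavity between \<open>p\<close> and the abscissa \<open>n/8\<close> gives \<open>u \<ge> M/7\<close> at \<open>3n/32\<close>,
  where decay gives \<open>u < M/8\<close>.\<close>

lemma not_mid_concave_rhombus:
  assumes n: "n > 1000"
    and small: "exp (- (pi / 640) * real n) / cos (pi / (2 * (31 / 32)) * (15 / 16)) < 1 / 8"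
    and u: "dirichlet_solution (rhombus n) lam u" "\<forall>x\<in>rhombus n. u x > 0"
  shows "\<not> mid_concave (rhombus n) u"
proof
  assume mc: "mid_concave (rhombus n) u"
  let ?D = "rhombus n"
  have n1: "n \<ge> 1" using n by simp
  have cont: "continuous_on (closure ?D) u" and bd: "\<And>x. x \<in> frontier ?D \<Longrightarrow> u x = 0"
    using u(1) by (auto simp: dirichlet_solution_def)
  have zero: "0 \<in> ?D" "0 \<in> closure ?D"
    using n1 closure_subset[of ?D] by (auto simp: mem_rhombus_iff)
  obtain p where p: "p \<in> closure ?D" and max: "\<And>x. x \<in> closure ?D \<Longrightarrow> u x \<le> u p"
    using continuous_attains_sup[of "closure ?D" u] bounded_rhombus[of n] cont zero
    by (metis compact_closure empty_iff)
  define M where "M = u p"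
  have "u 0 > 0" using u(2) zero by blast
  then have M: "M > 0" using max[OF zero(2)] by (simp add: M_def)
  then have pD: "p \<in> ?D"
    using bd[of p] p open_rhombus[OF n1] by (auto simp: M_def frontier_def interior_open)
  have le_M: "u x \<le> M" if "x \<in> ?D" for x
    using max[of x] that closure_subset[of ?D] by (auto simp: M_def)
  have decay: "u x < M / 8" if "x \<in> ?D" "3 * real n / 32 \<le> \<bar>x $ 1\<bar>" for x
  proof -
    have "u x \<le> M * (exp (- (pi / 640) * real n) / cos (pi / (2 * (31 / 32)) * (15 / 16)))"
      using positive_solution_rhombus_decay[OF n u M le_M that] by simp
    also have "\<dots> < M * (1 / 8)"
      using small M by (intro mult_strict_left_mono)
    finally show ?thesis by simp
  qed
  have p1: "\<bar>p $ 1\<bar> < 3 * real n / 32"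
    using decay[OF pD] M by (fastforce simp: M_def)
  (* Any K < 32/7 would do for the parabola: K/2 * (1 - p2^2) >= 1 then gives p2^2 < 9/16.
     The crude bound pi < 4 already allows K = 9/2. *)
  have "lam < 9 / 2"
  proof -
    have "pi\<^sup>2 < 4\<^sup>2"
      using pi_less_4 by (intro power_strict_mono) auto
    moreover have "lam \<le> pi\<^sup>2 * ((1 / 20)\<^sup>2 + (50 / 99)\<^sup>2)"
      using eigenvalue_rhombus_le[OF n u] by (simp add: power_divide)
    ultimately show ?thesis by (simp add: power2_eq_square)
  qed
  then have "u p \<le> 9 / 2 * M / 2 * (1 - (p $ 2)\<^sup>2)"
  proof (intro solution_le_parabola[OF open_rhombus[OF n1] bounded_rhombus u(1) _ M])
    fix x assume "x \<in> closure ?D"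
    moreover have "\<bar>x $ 1\<bar> / real n \<ge> 0" by simp
    ultimately show "\<bar>x $ 2\<bar> \<le> 1"
      using closure_rhombus_le[OF n1, of x] by linarith
  qed (use u(2) le_M pD in \<open>auto intro: less_imp_le\<close>)
  then have "M * 1 \<le> M * (9 / 4 * (1 - (p $ 2)\<^sup>2))"
    by (simp add: M_def algebra_simps)
  then have "1 \<le> 9 / 4 * (1 - (p $ 2)\<^sup>2)"
    using M by (simp only: mult_le_cancel_left_pos)
  then have "\<bar>p $ 2\<bar>\<^sup>2 < (3 / 4)\<^sup>2"
    by (simp add: power2_eq_square)
  then have p2: "\<bar>p $ 2\<bar> < 3 / 4"
    by (rule power2_less_imp_less) simp
  define b where "b = real n * (1 - \<bar>p $ 2\<bar>) / 2"
  have b: "real n / 8 \<le> b"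
    using n p2 by (simp add: b_def field_simps)
  define q e where "q = set_coord 1 (3 * real n / 32) p" and "e = set_coord 1 (real n / 8) p"
  have inD: "set_coord 1 s p \<in> ?D" if "\<bar>s\<bar> \<le> real n / 8" for s
  proof -
    have "\<bar>s\<bar> / real n \<le> 1 / 8"
      using that n by (simp add: field_simps)
    with p2 have "\<bar>s\<bar> / real n + \<bar>p $ 2\<bar> < 1"
      by linarith
    then show ?thesis
      using n1 by (simp add: mem_rhombus_iff set_coord_nth)
  qed
  have "concave_on (closed_segment (set_coord 1 (- b) p) (set_coord 1 b p)) u"
    using mid_concave_rhombus_row[OF mc n1, of p] p2 by (simp add: b_def)
  moreover have seg: "set_coord 1 s p \<in> closed_segment (set_coord 1 (- b) p) (set_coord 1 b p)"
    if "\<bar>s\<bar> \<le> real n / 8" for s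
    using that b n by (intro set_coord_mem_closed_segment) auto
  moreover have pc: "set_coord 1 (p $ 1) p = p"
    by (simp add: vec_eq_iff set_coord_nth)
  (* v is the position of the abscissa 3n/32 between p1 > - 3n/32 and n/8, hence
     1 - v = (n/32) / (n/8 - p1) >= 1/7. *)
  moreover define v where "v = (3 * real n / 32 - p $ 1) / (real n / 8 - p $ 1)"
  have v: "0 \<le> v" "v \<le> 6 / 7"
    using p1 n by (auto simp: v_def field_simps abs_less_iff)
  ultimately have concave: "u ((1 - v) *\<^sub>R p + v *\<^sub>R e) \<ge> (1 - v) * u p + v * u e"
    using p1 seg[of "p $ 1"] seg[of "real n / 8"] unfolding e_def
    by (intro concave_onD) auto
  have "(1 - v) *\<^sub>R p + v *\<^sub>R e = q"
  proof -
    have "(1 - v) * p $ 1 + v * (real n / 8) = p $ 1 + v * (real n / 8 - p $ 1)"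
      by (simp add: algebra_simps)
    also have "\<dots> = 3 * real n / 32"
      using p1 n by (simp add: v_def)
    finally have "(1 - v) * p $ 1 + v * (real n / 8) = 3 * real n / 32" .
    then have "(1 - v) *\<^sub>R set_coord 1 (p $ 1) p + v *\<^sub>R e = q"
      using set_coord_convex_combination[OF diff_add_cancel, of v 1 "p $ 1" p "real n / 8"]
      by (simp only: e_def q_def)
    then show ?thesis
      by (simp only: pc)
  qed
  with concave have "(1 - v) * u p + v * u e \<le> u q"
    by (simp only:)
  moreover have "0 \<le> v * u e"
    using v(1) bspec[OF u(2) inD[of "real n / 8"]] by (simp add: e_def)
  moreover have "1 / 7 * M \<le> (1 - v) * u p"
    unfolding M_def[symmetric] using v(2) M by (intro mult_right_mono) auto
  moreover have "u q < M / 8"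
    unfolding q_def using n by (intro decay inD) (auto simp: set_coord_nth)
  ultimately show False
    using M by linarith
qed

theorem proposition3p2:
  "\<exists>n::nat. n \<ge> 1 \<and>
     (\<forall>\<phi>. first_dirichlet_eigenfunction (rhombus n) \<phi> \<longrightarrow> \<not> mid_concave (rhombus n) \<phi>)"
proof -
  define c where "c = cos (pi / (2 * (31 / 32)) * (15 / 16))"
  have "(\<lambda>n. exp (- (pi / 640) * real n)) \<longlonglongrightarrow> 0"
    by real_asymp
  then have "(\<lambda>n. exp (- (pi / 640) * real n) / c) \<longlonglongrightarrow> 0"
    unfolding divide_inverse by (rule tendsto_mult_left_zero)
  then have "\<forall>\<^sub>F n in sequentially. exp (- (pi / 640) * real n) / c < 1 / 8 \<and> n > 1000"
    by (intro eventually_conj order_tendstoD eventually_gt_at_top) auto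
  then obtain n where n: "n > 1000" "exp (- (pi / 640) * real n) / c < 1 / 8"
    using eventually_happens by force
  then have "\<not> mid_concave (rhombus n) \<phi>" if "first_dirichlet_eigenfunction (rhombus n) \<phi>" for \<phi>
    using that not_mid_concave_rhombus
    unfolding first_dirichlet_eigenfunction_def c_def by blast
  with n(1) show ?thesis
    by (intro exI[of _ n]) auto
qed

end
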